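(* Let $\psi(f,g,h,u,v,w)=f(v-w)+g(w-u)+h(u-v)$. For arbitrary parameters $p,q,r,a,b,c$, define \[ \begin{aligned} x_1&=\psi(p,q,r,a,b,c), & x_2&=\psi(p,q,r,b,c,a), & x_3&=\psi(p,q,r,c,a,b),\\ y_1&=\psi(p,q,r,a,c,b), & y_2&=\psi(p,q,r,c,b,a), & y_3&=\psi(p,q,r,b,a,c). \end{aligned} \] Then \[ x_1^j+x_2^j+x_3^j=y_1^j+y_2^j+y_3^j \quad\text{for } j=1,2,4. \]
   Context: Parameters $p,q,r,a,b,c$ are arbitrary integers (or rationals). *)

theory Defs
  imports Main
begin

definition psi :: "'a::comm_ring_1 \<Rightarrow> 'a \<Rightarrow> 'a \<Rightarrow> 'a \<Rightarrow> 'a \<Rightarrow> 'a \<Rightarrow> 'a"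
  where "psi f g h u v w = f * (v - w) + g * (w - u) + h * (u - v)"

end

theory Submission
  imports Defs
begin

text \<open>Both triples have sum zero and the same second elementary symmetric function \<open>e\<close>.
  For a triple with sum zero, Newton's identities give \<open>- 2 * e\<close> as the sum of squares and
  \<open>2 * e ^ 2\<close> as the sum of fourth powers. Comparing \<open>e\<close> rather than the sums of squares
  avoids a division by 2, which is not available in a general commutative ring.\<close>

lemma sum_squares_of_sum_zero:
  fixes x y z :: "'a::comm_ring_1"
  assumes "x + y + z = 0"
  shows "x ^ 2 + y ^ 2 + z ^ 2 = - 2 * (x * y + y * z + z * x)"
proof -
  have z: "z = - x - y"
    using assms by (simp add: algebra_simps eq_neg_iff_add_eq_0)
  show ?thesis
    unfolding z by (simp add: algebra_simps power2_eq_square power4_eq_xxxx)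
qed

lemma sum_fourth_powers_of_sum_zero:
  fixes x y z :: "'a::comm_ring_1"
  assumes "x + y + z = 0"
  shows "x ^ 4 + y ^ 4 + z ^ 4 = 2 * (x * y + y * z + z * x) ^ 2"
proof -
  have z: "z = - x - y"
    using assms by (simp add: algebra_simps eq_neg_iff_add_eq_0)
  show ?thesis
    unfolding z by (simp add: algebra_simps power2_eq_square power4_eq_xxxx)
qed

text \<open>Over the three cyclic shifts each of \<open>p\<close>, \<open>q\<close>,
  \<open>r\<close> gets the factor \<open>(v - w) + (w - u) + (u - v) = 0\<close>.\<close>

lemma psi_cyclic_sum:
  "psi p q r u v w + psi p q r v w u + psi p q r w u v = 0"
  unfolding psi_def by (simp add: algebra_simps)

text \<open>With D the second elementary symmetric function of \<open>b - c\<close>,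
  \<open>c - a\<close>, \<open>a - b\<close>, the left side is D times
  \<open>p^2 + q^2 + r^2 - p*q - q*r - r*p\<close>. Swapping \<open>b\<close> and \<open>c\<close>
  negates and permutes the differences, so D is unchanged.\<close>

lemma psi_cyclic_e2_swap:
  "psi p q r a b c * psi p q r b c a + psi p q r b c a * psi p q r c a b
      + psi p q r c a b * psi p q r a b c
    = psi p q r a c b * psi p q r c b a + psi p q r c b a * psi p q r b a c
      + psi p q r b a c * psi p q r a c b"
  unfolding psi_def by (simp add: algebra_simps)

theorem theorem4:
  fixes p q r a b c x1 x2 x3 y1 y2 y3 :: "'a::comm_ring_1"
  assumes "x1 = psi p q r a b c" and "x2 = psi p q r b c a" and "x3 = psi p q r c a b"
    and "y1 = psi p q r a c b" and "y2 = psi p q r c b a" and "y3 = psi p q r b a c"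
  shows "\<forall>j\<in>{1, 2, 4::nat}. x1 ^ j + x2 ^ j + x3 ^ j = y1 ^ j + y2 ^ j + y3 ^ j"
proof -
  \<comment> \<open>The \<open>y\<close> triple runs through the cyclic shifts of
    \<open>(a, c, b)\<close>.\<close>
  have x: "x1 + x2 + x3 = 0" and y: "y1 + y2 + y3 = 0"
    unfolding assms by (rule psi_cyclic_sum)+
  have e: "x1 * x2 + x2 * x3 + x3 * x1 = y1 * y2 + y2 * y3 + y3 * y1"
    unfolding assms by (rule psi_cyclic_e2_swap)
  show ?thesis
    using x y sum_squares_of_sum_zero[OF x] sum_squares_of_sum_zero[OF y]
      sum_fourth_powers_of_sum_zero[OF x] sum_fourth_powers_of_sum_zero[OF y]
    by (simp add: e)
qed

end
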